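(* Let $G$ be a graph of order $n$ and minimum degree $\delta$. Then $$\eta(G)\ge \frac{n}{(n-\delta)^2}+\frac12-\frac{1}{2(n-\delta)}.$$ Moreover, the bound is sharp: for every pair of integers $a\ge 1$ and $b\ge 1$, there exists a graph $G$, of order $n$ and minimum degree $\delta$, with $\eta(G)=a$ and $n-\delta=b$, for which equality holds in the displayed inequality.
   Context: All graphs are finite and simple (with at least one vertex). $\mathbb N$ denotes the positive integers and $[k]=\{1,2,\ldots,k\}$. For a graph $G$ and a labeling $\ell:V(G)\to\mathbb N$, put $S_\ell(v)=\sum_{w\in N(v)}\ell(w)$, where $N(v)$ is the open neighborhood of $v$. The labeling $\ell$ is an additive labeling if $S_\ell(u)\ne S_\ell(v)$ for every edge $uv\in E(G)$. The additive number $\eta(G)$ is the least positive integer $k$ such that $G$ has an additive labeling $\ell:V(G)\to[k]$. *)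

theory Defs
  imports Complex_Main "HOL-Library.Nat_Bijection" "HOL-Library.FuncSet" "Graph_Theory.Pair_Digraph"
begin

text \<open>
  Finite simple graphs are the instances of the locale \<^locale>\<open>pair_graph\<close> (finite, loop-free, with a
  symmetric arc relation); an edge \<open>uv\<close> is the pair of arcs \<open>(u, v)\<close> and \<open>(v, u)\<close>.
  The locale admits the graph without vertices.
\<close>

definition neighborhood :: "'a pair_pre_digraph \<Rightarrow> 'a \<Rightarrow> 'a set" where
  "neighborhood G v = {w. (v, w) \<in> parcs G}"

text \<open>In a symmetric graph the out-degree of a vertex is its degree.\<close>

definition min_degree :: "'a pair_pre_digraph \<Rightarrow> nat" where
  "min_degree G = Min (out_degree (with_proj G) ` pverts G)"

definition nbr_sum :: "'a pair_pre_digraph \<Rightarrow> ('a \<Rightarrow> nat) \<Rightarrow> 'a \<Rightarrow> nat" where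
  "nbr_sum G l v = (\<Sum>w\<in>neighborhood G v. l w)"

text \<open>Only the values of a labeling on \<^term>\<open>pverts G\<close> are relevant.\<close>

definition additive_labeling :: "'a pair_pre_digraph \<Rightarrow> ('a \<Rightarrow> nat) \<Rightarrow> bool" where
  "additive_labeling G l \<longleftrightarrow>
     (\<forall>v\<in>pverts G. 1 \<le> l v) \<and> (\<forall>(u, v)\<in>parcs G. nbr_sum G l u \<noteq> nbr_sum G l v)"

definition additive_number :: "'a pair_pre_digraph \<Rightarrow> nat" where
  "additive_number G = (LEAST k. 1 \<le> k \<and> (\<exists>l \<in> pverts G \<rightarrow> {1..k}. additive_labeling G l))"

lemma (in pair_graph) out_degree_eq_card_neighborhood:
  "out_degree (with_proj G) v = card (neighborhood G v)"
proof -
  have "out_arcs (with_proj G) v = Pair v ` neighborhood G v"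
    by (auto simp: out_arcs_def neighborhood_def)
  then show ?thesis
    by (simp add: out_degree_def card_image inj_on_def)
qed

text \<open>
  The minimum in \<^const>\<open>additive_number\<close> is attained: label the vertices with distinct powers of 2.
\<close>

lemma (in pair_graph) additive_labeling_exists:
  "\<exists>k\<ge>1. \<exists>l \<in> pverts G \<rightarrow> {1..k}. additive_labeling G l"
proof -
  obtain f :: "'a \<Rightarrow> nat" where f: "inj_on f (pverts G)"
    using finite_imp_inj_to_nat_seg[OF pair_finite_verts] by blast
  define l :: "'a \<Rightarrow> nat" where "l v = 2 ^ f v" for v
  have sub: "neighborhood G v \<subseteq> pverts G" for v
    using in_arcsD2 by (auto simp: neighborhood_def)
  have S: "nbr_sum G l v = set_encode (f ` neighborhood G v)" for v
    by (simp add: nbr_sum_def set_encode_def l_def sum.reindex inj_on_subset[OF f sub])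
  have fin: "finite (f ` neighborhood G v)" for v
    using finite_subset[OF sub pair_finite_verts] by simp
  have ne: "nbr_sum G l u \<noteq> nbr_sum G l v" if uv: "(u, v) \<in> parcs G" for u v
  proof
    assume "nbr_sum G l u = nbr_sum G l v"
    then have "f ` neighborhood G u = f ` neighborhood G v"
      using fin by (simp add: S set_encode_eq)
    then have "neighborhood G u = neighborhood G v"
      using inj_on_image_eq_iff[OF f sub sub] by simp
    then have "(v, v) \<in> parcs G"
      using uv by (auto simp: neighborhood_def)
    then show False
      using pair_no_loops by fastforce
  qed
  define k where "k = Suc (sum l (pverts G))"
  have "l v \<in> {1..k}" if "v \<in> pverts G" for v
    using member_le_sum[OF that, of l] pair_finite_verts by (simp add: k_def l_def)
  moreover have "additive_labeling G l"
    using ne by (auto simp: additive_labeling_def l_def)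
  moreover have "1 \<le> k"
    by (simp add: k_def)
  ultimately show ?thesis
    by blast
qed

end

theory Submission
  imports Defs
begin

text \<open>
  Let \<open>D v\<close> be the sum of the labels over the non-neighbours of \<open>v\<close>, with \<open>v\<close> itself included, and
  put \<open>r = n - \<delta>\<close>. Adjacent vertices have different values of \<open>D\<close>, so for each \<open>d\<close> the vertices
  with \<open>D v = d\<close> are pairwise non-neighbours: there are at most \<open>r\<close> of them, and at most \<open>d\<close> of them
  since each contributes a label \<open>\<ge> 1\<close> to \<open>d\<close>. As \<open>1 \<le> D v \<le> k r\<close> for labels in \<open>[k]\<close>, this gives
  \<open>n \<le> (\<Sum>d = 1..k r. min d r) = k r\<^sup>2 - r\<^sup>2 / 2 + r / 2\<close>. Equality forces complete multipartite graphs
  with parts of sizes \<open>min d r\<close> for \<open>d = 1, \<dots>, k r\<close>, where the part with index \<open>d\<close> has label sum \<open>d\<close>.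
\<close>

section \<open>Arithmetic of sums of minima and of quotients\<close>

lemma sum_min_closed_form:
  fixes r m :: nat
  shows "2 * (\<Sum>d = 1..r + m. min d r) = r * (r + 1) + 2 * m * r"
\<comment> \<open>Up to the limit \<open>r\<close> every term is \<open>d\<close>, which gives a
  Gauss sum; each index beyond \<open>r\<close> adds the constant \<open>r\<close>.\<close>
proof (induction m)
  case 0
  have "(\<Sum>d = 1..r. min d r) = \<Sum>{1..r}"
    by (rule sum.cong) auto
  then show ?case
    using gauss_sum_from_Suc_0[of r, where 'a = nat] by (simp add: algebra_simps)
next
  case (Suc m)
  then show ?case
    by (simp add: algebra_simps)
qed

text \<open>The closed form of the sum solved for \<open>k\<close>. It turns the counting bound into
  the displayed one and also yields equality for the extremal graphs.\<close>

lemma real_sum_min_closed_form: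
  fixes r k :: nat
  assumes "1 \<le> k" "1 \<le> r"
  shows "real k = real (\<Sum>d = 1..k * r. min d r) / (real r)\<^sup>2 + 1 / 2 - 1 / (2 * real r)"
proof -
  \<comment> \<open>Then \<open>k * r\<close> is \<open>r + j * r\<close>, the shape of limit in
    \<open>sum_min_closed_form\<close>.\<close>
  obtain j where k: "k = Suc j"
    using assms(1) by (cases k) auto
  define N where "N = (\<Sum>d = 1..k * r. min d r)"
  have "2 * N = r * (r + 1) + 2 * (j * r) * r"
    using sum_min_closed_form[of r "j * r"] by (simp only: N_def k mult_Suc)
  then have "real (2 * N) = real (r * (r + 1) + 2 * (j * r) * r)"
    by (simp only:)
  then have "real N = real r * real r * (real k - 1 / 2) + real r / 2"
    by (simp add: k algebra_simps)
  then have "real N / (real r)\<^sup>2 = real k - 1 / 2 + 1 / (2 * real r)"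
    using assms(2) by (simp add: power2_eq_square add_divide_distrib)
  then show ?thesis
    by (simp only: N_def)
qed

text \<open>Hermite's identity at \<open>d / m\<close>: it splits \<open>d\<close> into
  \<open>m\<close> nearly equal integers. Raising \<open>d\<close> by one shifts the window of
  summands, trading \<open>d div m\<close> for \<open>(d + m) div m\<close>, which is one
  larger.\<close>

lemma sum_div_shifted:
  fixes m d :: nat
  assumes "0 < m"
  shows "(\<Sum>i<m. (d + i) div m) = d"
proof (induction d)
  case 0
  then show ?case by simp
next
  case (Suc d)
  have "d div m + (\<Sum>i<m. (Suc d + i) div m) = (\<Sum>i<Suc m. (d + i) div m)"
    by (subst sum.lessThan_Suc_shift) simp
  also have "\<dots> = d + (d div m + 1)"
    using Suc assms by simp
  finally show ?case by simp
qed

section \<open>The counting argument and the lower bound\<close>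

lemma (in pair_graph) neighborhood_subset: "neighborhood G v \<subseteq> pverts G"
  using in_arcsD2 by (auto simp: neighborhood_def)

lemma (in pair_graph) self_notin_neighborhood: "v \<notin> neighborhood G v"
  using pair_no_loops by (fastforce simp: neighborhood_def)

lemma (in pair_graph) card_le_sum_min:
  assumes "additive_labeling G l" "l \<in> pverts G \<rightarrow> {1..k}"
    and r: "\<And>v. v \<in> pverts G \<Longrightarrow> card (pverts G - neighborhood G v) \<le> r"
  shows "card (pverts G) \<le> (\<Sum>d = 1..k * r. min d r)"
proof -
  let ?V = "pverts G"
  define M where "M v = ?V - neighborhood G v" for v
  define D where "D v = sum l (M v)" for v
  have finM: "finite (M v)" for v
    by (simp add: M_def pair_finite_verts)
  have l: "1 \<le> l v" "l v \<le> k" if "v \<in> ?V" for v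
    using assms(2) that by (auto simp: Pi_iff)
  have total: "nbr_sum G l v + D v = sum l ?V" for v
    using sum.subset_diff[OF neighborhood_subset pair_finite_verts, of l v]
    by (simp add: nbr_sum_def D_def M_def)
  \<comment> \<open>Used twice: with \<open>{v}\<close> for \<open>1 \<le> D v\<close>, and with a
    whole level set of \<open>D\<close> for the bound \<open>d\<close>.\<close>
  have card_le_D: "card C \<le> D v" if "C \<subseteq> M v" for C v
  proof -
    have "card C \<le> sum l C"
      using sum_mono[of C "\<lambda>_. 1" l] l that by (force simp: M_def)
    also have "\<dots> \<le> D v"
      unfolding D_def by (rule sum_mono2[OF finM that]) simp
    finally show ?thesis .
  qed
  have D_range: "D v \<in> {1..k * r}" if v: "v \<in> ?V" for v
  proof -
    have "v \<in> M v"
      using v self_notin_neighborhood by (simp add: M_def)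
    then have "1 \<le> D v"
      using card_le_D[of "{v}" v] by simp
    moreover have "D v \<le> card (M v) * k"
      unfolding D_def using sum_bounded_above[of "M v" l k] l by (simp add: M_def)
    moreover have "card (M v) * k \<le> r * k"
      using r[OF v] by (simp add: M_def)
    ultimately show ?thesis
      unfolding mult.commute[of k] by (meson atLeastAtMost_iff le_trans)
  qed
  have cls: "card {v \<in> ?V. D v = d} \<le> min d r" for d
  proof (cases "{v \<in> ?V. D v = d} = {}")
    case False
    then obtain v where v: "v \<in> ?V" "D v = d" by blast
    \<comment> \<open>By \<open>total\<close>, equal values of \<open>D\<close> mean equal neighbour
      sums, so such vertices are not adjacent.\<close>
    have sub: "{w \<in> ?V. D w = d} \<subseteq> M v"
    proof
      fix w assume w: "w \<in> {w \<in> ?V. D w = d}"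
      then have "nbr_sum G l v = nbr_sum G l w"
        using total[of v] total[of w] v by simp
      then have "(v, w) \<notin> parcs G"
        using assms(1) by (auto simp: additive_labeling_def)
      then show "w \<in> M v"
        using w by (simp add: M_def neighborhood_def)
    qed
    have "card {w \<in> ?V. D w = d} \<le> d"
      using card_le_D[OF sub] v(2) by simp
    moreover have "card {w \<in> ?V. D w = d} \<le> r"
      using card_mono[OF finM sub] r[OF v(1)] unfolding M_def by (rule le_trans)
    ultimately show ?thesis by simp
  qed (simp only: card.empty)
  \<comment> \<open>Count the vertices by their value of \<open>D\<close>.\<close>
  have "card ?V = (\<Sum>d = 1..k * r. card {v \<in> ?V. D v = d})"
    using sum.group[OF pair_finite_verts, of "{1..k * r}" D "\<lambda>_. 1::nat"] D_range by force
  also have "\<dots> \<le> (\<Sum>d = 1..k * r. min d r)"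
    by (rule sum_mono) (rule cls)
  finally show ?thesis .
qed

lemma (in pair_graph) additive_number_attained:
  "1 \<le> additive_number G"
  "\<exists>l \<in> pverts G \<rightarrow> {1..additive_number G}. additive_labeling G l"
  using LeastI_ex[OF additive_labeling_exists] by (simp_all add: additive_number_def)

lemma (in pair_graph) min_degree_le:
  "v \<in> pverts G \<Longrightarrow> min_degree G \<le> card (neighborhood G v)"
  unfolding min_degree_def out_degree_eq_card_neighborhood
  by (rule Min_le) (auto simp: pair_finite_verts)

lemma (in pair_graph) additive_number_lower_bound:
  assumes "pverts G \<noteq> {}"
  shows "real (card (pverts G)) / (real (card (pverts G)) - real (min_degree G))\<^sup>2 + 1 / 2
           - 1 / (2 * (real (card (pverts G)) - real (min_degree G))) \<le> real (additive_number G)"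
proof -
  define n where "n = card (pverts G)"
  define r where "r = n - min_degree G"
  have card_nbr: "card (neighborhood G v) < n" if "v \<in> pverts G" for v
    unfolding n_def using neighborhood_subset self_notin_neighborhood that pair_finite_verts
    by (metis psubsetI psubset_card_mono)
  \<comment> \<open>Makes \<open>r\<close> positive and the truncated difference
    \<open>n - min_degree G\<close> a true one, as the passage to reals requires.\<close>
  have lt: "min_degree G < n"
    using assms min_degree_le card_nbr by (meson ex_in_conv le_less_trans)
  have r: "card (pverts G - neighborhood G v) \<le> r" if "v \<in> pverts G" for v
    using min_degree_le[OF that] neighborhood_subset pair_finite_verts
    by (simp add: r_def n_def card_Diff_subset finite_subset[OF neighborhood_subset])
  have "n \<le> (\<Sum>d = 1..additive_number G * r. min d r)"
    using additive_number_attained(2) card_le_sum_min r unfolding n_def by blast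
  then have "real n \<le> real (\<Sum>d = 1..additive_number G * r. min d r)"
    by (rule of_nat_mono)
  then have "real n / (real r)\<^sup>2 \<le> real (\<Sum>d = 1..additive_number G * r. min d r) / (real r)\<^sup>2"
    by (rule divide_right_mono) simp
  moreover have "real r = real n - real (min_degree G)" "1 \<le> r"
    using lt by (auto simp: r_def of_nat_diff)
  ultimately show ?thesis
    using real_sum_min_closed_form[OF additive_number_attained(1), of r] unfolding n_def by simp
qed

section \<open>Sharpness: complete multipartite graphs with the fibres of \<open>p\<close> as
  parts\<close>

definition multipartite :: "'a set \<Rightarrow> ('a \<Rightarrow> 'b) \<Rightarrow> 'a pair_pre_digraph" where
  "multipartite V p = \<lparr>pverts = V, parcs = {(u, v) \<in> V \<times> V. p u \<noteq> p v}\<rparr>"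

lemma pair_graph_multipartite:
  assumes "finite V"
  shows "pair_graph (multipartite V p)"
proof
  show "finite (parcs (multipartite V p))"
    by (rule finite_subset[of _ "V \<times> V"]) (auto simp: multipartite_def assms)
qed (auto simp: multipartite_def assms symmetric_def sym_def)

lemma neighborhood_multipartite:
  "v \<in> V \<Longrightarrow> neighborhood (multipartite V p) v = V - {w \<in> V. p w = p v}"
  by (auto simp: neighborhood_def multipartite_def)

text \<open>A vertex misses exactly its own part, so the minimum degree is attained in a largest
  part.\<close>

lemma min_degree_multipartite:
  assumes "finite V" "v \<in> V" "card {w \<in> V. p w = p v} = b"
    and max: "\<And>u. u \<in> V \<Longrightarrow> card {w \<in> V. p w = p u} \<le> b"
  shows "min_degree (multipartite V p) = card V - b"
proof -
  interpret pair_graph "multipartite V p"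
    by (rule pair_graph_multipartite) fact
  have deg: "out_degree (with_proj (multipartite V p)) u = card V - card {w \<in> V. p w = p u}"
    if "u \<in> V" for u
    using that assms(1)
    by (simp add: out_degree_eq_card_neighborhood neighborhood_multipartite card_Diff_subset)
  have V: "pverts (multipartite V p) = V"
    by (simp add: multipartite_def)
  show ?thesis
    unfolding min_degree_def V
  proof (rule Min_eqI)
    show "card V - b \<in> out_degree (with_proj (multipartite V p)) ` V"
      using deg[OF assms(2)] assms(2,3) by (metis imageI)
  next
    fix y assume "y \<in> out_degree (with_proj (multipartite V p)) ` V"
    then show "card V - b \<le> y"
      using deg max by (auto intro: diff_le_mono2)
  qed (simp add: assms(1))
qed

text \<open>The index of a part doubles as its label sum. Hence neighbour sums are the total minus
  \<open>p v\<close>, and adjacent vertices differ in \<open>p\<close>.\<close>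

lemma additive_labeling_multipartite:
  assumes "finite V" "\<And>v. v \<in> V \<Longrightarrow> 1 \<le> l v"
    and part_sum: "\<And>v. v \<in> V \<Longrightarrow> sum l {w \<in> V. p w = p v} = p v"
  shows "additive_labeling (multipartite V p) l"
proof -
  have sum_V: "nbr_sum (multipartite V p) l v + p v = sum l V" if "v \<in> V" for v
    using sum.subset_diff[of "{w \<in> V. p w = p v}" V l] that assms(1) part_sum[OF that]
    by (simp add: nbr_sum_def neighborhood_multipartite)
  have "nbr_sum (multipartite V p) l u \<noteq> nbr_sum (multipartite V p) l v"
    if "(u, v) \<in> parcs (multipartite V p)" for u v
    using that sum_V[of u] sum_V[of v] by (auto simp: multipartite_def)
  moreover have "pverts (multipartite V p) = V"
    by (simp add: multipartite_def)
  ultimately show ?thesis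
    using assms(2) by (auto simp: additive_labeling_def)
qed

text \<open>Only an upper bound on the additive number is constructed: the order is the extremal
  one, so the general lower bound supplies the converse.\<close>

lemma sharp_multipartite:
  fixes a b :: nat
  assumes a: "1 \<le> a" and b: "1 \<le> b"
  obtains G :: "nat pair_pre_digraph"
  where "pair_graph G" "pverts G \<noteq> {}" "additive_number G \<le> a"
    "card (pverts G) = (\<Sum>d = 1..a * b. min d b)" "min_degree G + b = card (pverts G)"
proof -
  \<comment> \<open>The tag \<open>d\<close> in the code of a vertex keeps the parts disjoint and
    lets \<open>p\<close> recover the index.\<close>
  define P where "P d = (\<lambda>i. prod_encode (d, i)) ` {..<min d b}" for d
  define V where "V = (\<Union>d\<in>{1..a * b}. P d)"
  define p where "p = (\<lambda>v. fst (prod_decode v))"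
  \<comment> \<open>The balanced splitting of \<open>d\<close> over the part \<open>P d\<close>, by
    \<open>sum_div_shifted\<close>.\<close>
  define l where "l v = (let (d, i) = prod_decode v in (d + i) div min d b)" for v
  have inj: "inj_on (\<lambda>i. prod_encode (d, i)) A" for d A
    by (simp add: inj_on_def)
  have card_P: "card (P d) = min d b" for d
    by (simp add: P_def card_image[OF inj])
  have finV: "finite V"
    by (simp add: V_def P_def)
  have p_range: "p v \<in> {1..a * b}" if "v \<in> V" for v
    using that by (auto simp: V_def P_def p_def)
  have part: "{w \<in> V. p w = d} = P d" if "d \<in> {1..a * b}" for d
    using that by (auto simp: V_def P_def p_def)
  have card_V: "card V = (\<Sum>d = 1..a * b. min d b)"
    unfolding V_def by (subst card_UN_disjoint) (auto simp: card_P, auto simp: P_def)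
  \<comment> \<open>The index \<open>b\<close> occurs, and its part has the maximal size
    \<open>b\<close>.\<close>
  have b_range: "b \<in> {1..a * b}"
    using a b by simp
  define v0 where "v0 = prod_encode (b, 0)"
  have "v0 \<in> P b"
    using b by (simp add: P_def v0_def)
  then have v0: "v0 \<in> V" "p v0 = b"
    using b_range by (auto simp only: V_def) (simp add: p_def v0_def)
  have min_deg: "min_degree (multipartite V p) = card V - b"
    by (rule min_degree_multipartite[OF finV v0(1)])
      (use v0 p_range part card_P in \<open>auto simp del: atLeastAtMost_iff\<close>)
  have "b \<le> card V"
    using card_mono[OF finV, of "P b"] card_P[of b] part[OF b_range] by auto
  have l_range: "l v \<in> {1..a}" if in_V: "v \<in> V" for v
  proof -
    obtain d i where v: "v = prod_encode (d, i)" and d: "d \<le> a * b" and i: "i < d" "i < b"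
      using in_V by (auto simp: V_def P_def)
    have "l v = (d + i) div min d b"
      by (simp add: v l_def)
    moreover have "1 \<le> (d + i) div min d b"
      using i by (simp add: div_greater_zero_iff Suc_le_eq)
    moreover have "(d + i) div min d b \<le> a"
    \<comment> \<open>For \<open>d \<le> b\<close> the divisor is \<open>d\<close> and
      \<open>i < d\<close>, so the quotient is 1; otherwise the divisor is \<open>b\<close> and
      \<open>d + i < a * b + b\<close>.\<close>
    proof (cases "d \<le> b")
      case True
      then show ?thesis
        using i a by simp
    next
      case False
      have "(d + i) div b < Suc a"
        using d i by (intro less_mult_imp_div_less) simp
      then show ?thesis
        using False by simp
    qed
    ultimately show ?thesis by simp
  qed
  have "sum l (P d) = d" if "d \<in> {1..a * b}" for d
    using that b sum_div_shifted[of "min d b" d]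
    by (simp add: P_def sum.reindex[OF inj] l_def)
  then have "additive_labeling (multipartite V p) l"
    using finV l_range p_range part by (intro additive_labeling_multipartite) auto
  then have "additive_number (multipartite V p) \<le> a"
    unfolding additive_number_def using a l_range
    by (intro Least_le) (auto simp: multipartite_def)
  then show ?thesis
    using that[of "multipartite V p"] pair_graph_multipartite[OF finV] v0(1) card_V min_deg
      \<open>b \<le> card V\<close>
    by (auto simp: multipartite_def)
qed

theorem theorem2:
  shows "(\<forall>(G :: 'a pair_pre_digraph) (n :: nat) (\<delta> :: nat).
            pair_graph G \<and> pverts G \<noteq> {} \<and> n = card (pverts G) \<and> \<delta> = min_degree G \<longrightarrow>
            real (additive_number G) \<ge>
              real n / (real n - real \<delta>)^2 + 1/2 - 1 / (2 * (real n - real \<delta>)))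
       \<and> (\<forall>(a :: nat) (b :: nat). a \<ge> 1 \<and> b \<ge> 1 \<longrightarrow>
            (\<exists>(G :: nat pair_pre_digraph) (n :: nat) (\<delta> :: nat).
               pair_graph G \<and> pverts G \<noteq> {} \<and> n = card (pverts G) \<and> \<delta> = min_degree G \<and>
               additive_number G = a \<and> int n - int \<delta> = int b \<and>
               real (additive_number G) =
                 real n / (real n - real \<delta>)^2 + 1/2 - 1 / (2 * (real n - real \<delta>))))"
proof (intro conjI allI impI; elim conjE)
  fix G :: "'a pair_pre_digraph" and n \<delta> :: nat
  assume "pair_graph G" "pverts G \<noteq> {}" "n = card (pverts G)" "\<delta> = min_degree G"
  then show "real (additive_number G) \<ge>
      real n / (real n - real \<delta>)^2 + 1/2 - 1 / (2 * (real n - real \<delta>))"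
    using pair_graph.additive_number_lower_bound by blast
next
  fix a b :: nat
  assume a: "a \<ge> 1" and b: "b \<ge> 1"
  obtain G :: "nat pair_pre_digraph" where G: "pair_graph G" "pverts G \<noteq> {}"
    and le: "additive_number G \<le> a"
    and n: "card (pverts G) = (\<Sum>d = 1..a * b. min d b)"
    and \<delta>: "min_degree G + b = card (pverts G)"
    by (rule sharp_multipartite[OF a b])
  have diff: "real (card (pverts G)) - real (min_degree G) = real b"
    using \<delta> by linarith
  have bound: "real (card (pverts G)) / (real b)\<^sup>2 + 1 / 2 - 1 / (2 * real b) = real a"
    unfolding n by (rule real_sum_min_closed_form[OF a b, symmetric])
  \<comment> \<open>For this order and minimum degree the lower bound evaluates to exactly
    \<open>a\<close>.\<close>
  then have "real a \<le> real (additive_number G)"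
    using pair_graph.additive_number_lower_bound[OF G] unfolding diff by simp
  then have "additive_number G = a"
    using le by simp
  moreover have "int (card (pverts G)) - int (min_degree G) = int b"
    using \<delta> by linarith
  ultimately show "\<exists>(G :: nat pair_pre_digraph) (n :: nat) (\<delta> :: nat).
      pair_graph G \<and> pverts G \<noteq> {} \<and> n = card (pverts G) \<and> \<delta> = min_degree G \<and>
      additive_number G = a \<and> int n - int \<delta> = int b \<and>
      real (additive_number G) =
        real n / (real n - real \<delta>)^2 + 1/2 - 1 / (2 * (real n - real \<delta>))"
    using G bound diff by metis
qed

end
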